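(* For any positive number $\alpha$ consider the function $H_\alpha$ and the quantities $c_\alpha$ and $s_\alpha$ defined in the context. Then: (i) $H_\alpha$ satisfies the differential equation $H_\alpha'(z)=\alpha+z+(z^{-1}-1)H_\alpha(z)$ for all $z\in\mathbb{C}\setminus[0,\infty)$. (ii) $s_\alpha=\frac{c_\alpha}{1+c_\alpha}(\alpha-c_\alpha)$. (iii) $H_\alpha''(-c_\alpha)=1-\frac{s_\alpha}{c_\alpha^2}<0$. (iv) $\lim_{\alpha\to0}s_\alpha=0$ and $\lim_{\alpha\to\infty}s_\alpha=\infty$. (v) $c_\alpha$ is an analytic function of $\alpha$ (on $(0,\infty)$), and $\frac{dc_\alpha}{d\alpha}=\frac{c_\alpha(1+c_\alpha)}{\alpha(\alpha-2c_\alpha-c_\alpha^2)}$. (vi) $s_\alpha$ is an analytic function of $\alpha$ (on $(0,\infty)$), and $\frac{ds_\alpha}{d\alpha}=\frac{c_\alpha(\alpha+1)}{\alpha(1+c_\alpha)}$. In particular $s_\alpha$ is a strictly increasing function of $\alpha$.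
   Context: For $\alpha>0$, $H_\alpha\colon\mathbb{C}\setminus[0,\infty)\to\mathbb{C}$ is the analytic function \[ H_\alpha(z)=z+\alpha z\int_0^\infty\frac{e^{-t}}{z-t}\,dt=z+\alpha+\alpha\int_0^\infty\frac{te^{-t}}{z-t}\,dt . \] $c_\alpha$ is the unique positive real number such that $\int_0^\infty\frac{te^{-t}}{(c_\alpha+t)^2}\,dt=\frac1\alpha$, and $s_\alpha=H_\alpha(-c_\alpha)\in\mathbb{R}$. *)

theory Defs
  imports "HOL-Analysis.Analysis"
begin

definition H_alpha :: "real \<Rightarrow> complex \<Rightarrow> complex" where
  "H_alpha \<alpha> z = z + of_real \<alpha> * z *
     (LINT t:{0..}|lborel. of_real (exp (- t)) / (z - of_real t))"

definition c_alpha :: "real \<Rightarrow> real" where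
  "c_alpha \<alpha> = (THE c. 0 < c \<and> (LINT t:{0..}|lborel. t * exp (- t) / (c + t)\<^sup>2) = 1 / \<alpha>)"

text \<open>The value of \<^const>\<open>H_alpha\<close> at a real point is real, so taking the real part loses
  nothing; see \<open>of_real_s_alpha\<close>.\<close>

definition s_alpha :: "real \<Rightarrow> real" where
  "s_alpha \<alpha> = Re (H_alpha \<alpha> (- of_real (c_alpha \<alpha>)))"

lemma of_real_s_alpha: "of_real (s_alpha \<alpha>) = H_alpha \<alpha> (- of_real (c_alpha \<alpha>))"
proof -
  have "(LINT t:{0..}|lborel. of_real (exp (- t)) / (- of_real c - of_real t)) =
      complex_of_real (LINT t:{0..}|lborel. exp (- t) / (- c - t))" for c
    unfolding set_integral_complex_of_real [symmetric] by simp
  then have "H_alpha \<alpha> (- of_real (c_alpha \<alpha>)) \<in> \<real>"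
    unfolding H_alpha_def by (auto intro!: Reals_add Reals_mult)
  then show ?thesis
    unfolding s_alpha_def by (simp add: of_real_Re)
qed

text \<open>Real analyticity: near every point of \<open>S\<close> (an open set in the uses below), \<open>f\<close> is the sum
  of a convergent power series. The library's \<open>analytic_on\<close> is complex analyticity only.\<close>

definition real_analytic_on :: "(real \<Rightarrow> real) \<Rightarrow> real set \<Rightarrow> bool" where
  "real_analytic_on f S \<longleftrightarrow>
     (\<forall>x\<in>S. \<exists>r>0. \<exists>a :: nat \<Rightarrow> real. \<forall>y\<in>ball x r. (\<lambda>n. a n * (y - x) ^ n) sums f y)"

end

theory Submission
  imports Defs "HOL-Complex_Analysis.Complex_Analysis"
begin

text \<open>
  Write \<open>E\<^sub>n(z) = \<integral>\<^sub>0\<^sup>\<infinity> e\<^bsup>-t\<^esup> / (z + t)\<^sup>n dt\<close>, so that \<open>H\<^sub>\<alpha>(z) = z - \<alpha> z E\<^sub>1(-z)\<close>. Integration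
  by parts gives \<open>n E\<^bsub>n+1\<^esub> = z\<^bsup>-n\<^esup> - E\<^sub>n\<close> (\<open>exp_stieltjes_Suc\<close>), and differentiation under the
  integral sign gives \<open>E\<^sub>1' = - E\<^sub>2\<close>; hence \<open>E\<^sub>1\<close> solves the first order equation
  \<open>E\<^sub>1' = E\<^sub>1 - 1/z\<close>, which is the differential equation of \<open>H\<^sub>\<alpha>\<close> in disguise.

  Splitting \<open>t = (c + t) - c\<close> and using the recurrence turns the integral that defines \<open>c\<^sub>\<alpha>\<close> into
  \<open>\<phi>(c) = (1 + c) E\<^sub>1(c) - 1\<close>, so the equation for \<open>c\<^sub>\<alpha>\<close> determines
  \<open>E\<^sub>1(c\<^sub>\<alpha>) = (1 + \<alpha>) / (\<alpha> (1 + c\<^sub>\<alpha>))\<close>. After this substitution every formula of the theorem becomes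
  rational in \<open>\<alpha>\<close> and \<open>c\<^sub>\<alpha>\<close>. The one analytic inequality behind everything is \<open>\<phi>' < 0\<close>, which holds
  because \<open>\<phi>'(c)\<close> is \<open>-2 \<integral>\<^sub>0\<^sup>\<infinity> t e\<^bsup>-t\<^esup> / (c + t)\<^sup>3 dt\<close>. It makes \<open>\<phi>\<close> a decreasing bijection of \<open>(0, \<infinity>)\<close>
  onto itself, so that \<open>c\<^sub>\<alpha>\<close> exists, is unique and depends monotonically on \<open>\<alpha>\<close>. At \<open>c\<^sub>\<alpha>\<close> it reads
  \<open>2 c\<^sub>\<alpha> + c\<^sub>\<alpha>\<^sup>2 < \<alpha>\<close> (\<open>c_alpha_less\<close>), equivalently \<open>c\<^sub>\<alpha>\<^sup>2 < s\<^sub>\<alpha>\<close>: this is the sign of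
  \<open>H\<^sub>\<alpha>''(-c\<^sub>\<alpha>)\<close>, it keeps the derivative of \<open>c\<^sub>\<alpha>\<close> finite, and it yields both limits of \<open>s\<^sub>\<alpha>\<close>
  through \<open>0 < s\<^sub>\<alpha> \<le> \<alpha>\<close> and \<open>\<alpha> - c\<^sub>\<alpha> \<ge> \<alpha>/2\<close>.

  For analyticity, \<open>\<alpha> = 1 / \<phi>(c\<^sub>\<alpha>)\<close> exhibits \<open>c\<^sub>\<alpha>\<close> as the inverse of a function that extends
  holomorphically to the slit plane. The holomorphic inverse function theorem extends \<open>c\<^sub>\<alpha>\<close>, and
  with it \<open>s\<^sub>\<alpha>\<close>, holomorphically to a complex neighbourhood of each \<open>\<alpha> > 0\<close>; the real parts of the
  Taylor coefficients give the real power series.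
\<close>

section \<open>Integrals over the half-line with an exponential weight\<close>

lemma tendsto_exp_neg_at_top: "((\<lambda>t::real. exp (- t)) \<longlongrightarrow> 0) at_top"
  by (rule filterlim_compose [OF exp_at_bot filterlim_uminus_at_bot_at_top])

lemma integral_exp_neg_atLeast_0:
  shows set_integrable_exp_neg: "set_integrable lborel {0..} (\<lambda>t::real. exp (- t))"
    and set_integral_exp_neg: "(LINT t:{0..}|lborel. exp (- t)) = (1::real)"
proof -
  have *: "(((\<lambda>t::real. - exp (- t)) \<circ> real_of_ereal) \<longlongrightarrow> -1) (at_right 0)"
     "(((\<lambda>t::real. - exp (- t)) \<circ> real_of_ereal) \<longlongrightarrow> 0) (at_left \<infinity>)"
    unfolding zero_ereal_def ereal_tendsto_simps1
    using tendsto_minus [OF tendsto_exp_neg_at_top] by (auto intro!: tendsto_eq_intros)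
  have "set_integrable lborel (einterval 0 \<infinity>) (\<lambda>t::real. exp (- t))"
       "(LBINT t=0..\<infinity>. exp (- t)) = 0 - (- 1::real)"
    by (rule interval_integral_FTC_nonneg [OF _ _ _ _ *];
        force intro!: derivative_eq_intros continuous_intros)+
  moreover have e: "einterval 0 \<infinity> = {0::real<..}"
    by (auto simp: einterval_def)
  ultimately have i: "set_integrable lborel {0<..} (\<lambda>t::real. exp (- t))"
    and v: "(LINT t:{0<..}|lborel. exp (- t)) = (1::real)"
    by (simp_all add: interval_lebesgue_integral_def)
  show "set_integrable lborel {0..} (\<lambda>t::real. exp (- t))"
    using i by (subst set_integrable_discrete_difference [where X = "{0}" and B = "{0<..}"]) auto
  show "(LINT t:{0..}|lborel. exp (- t)) = (1::real)"
    using v by (subst set_integral_discrete_difference [where X = "{0}" and B = "{0<..}"]) auto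
qed

lemma set_integral_FTC_atLeast_0:
  fixes F f :: "real \<Rightarrow> complex"
  assumes deriv: "\<And>t. t \<ge> 0 \<Longrightarrow> (F has_vector_derivative f t) (at t)"
    and cont: "\<And>t. t \<ge> 0 \<Longrightarrow> isCont f t"
    and int: "set_integrable lborel {0..} f"
    and lim: "(F \<longlongrightarrow> L) at_top"
  shows "(LINT t:{0..}|lborel. f t) = L - F 0"
proof -
  have e: "einterval 0 \<infinity> = {0::real<..}"
    by (auto simp: einterval_def)
  have "isCont F 0"
    using deriv [of 0] has_vector_derivative_continuous by blast
  then have "(F \<longlongrightarrow> F 0) (at_right 0)"
    by (simp add: continuous_within filterlim_at_split)
  then have *: "((F \<circ> real_of_ereal) \<longlongrightarrow> F 0) (at_right 0)"
     "((F \<circ> real_of_ereal) \<longlongrightarrow> L) (at_left \<infinity>)"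
    unfolding zero_ereal_def ereal_tendsto_simps1 using lim by auto
  have "(LBINT t=0..\<infinity>. f t) = L - F 0"
    by (rule interval_integral_FTC_integrable [OF _ _ _ _ *])
       (use assms in \<open>auto simp: e intro: set_integrable_subset\<close>)
  then have "(LINT t:{0<..}|lborel. f t) = L - F 0"
    by (simp add: interval_lebesgue_integral_def e)
  then show ?thesis
    by (subst set_integral_discrete_difference [where X = "{0}" and B = "{0<..}"]) auto
qed

section \<open>The exponential Stieltjes transforms\<close>

definition exp_stieltjes :: "nat \<Rightarrow> complex \<Rightarrow> complex" where
  "exp_stieltjes n z = (LINT t:{0..}|lborel. of_real (exp (- t)) / (z + of_real t) ^ n)"

lemma nonpos_Reals_dist_bound:
  fixes z :: complex
  assumes "z \<notin> \<real>\<^sub>\<le>\<^sub>0"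
  obtains d where "d > 0" "\<And>t. t \<ge> 0 \<Longrightarrow> d \<le> cmod (z + of_real t)"
proof -
  obtain d where d: "d > 0" "\<And>x. x \<in> \<real>\<^sub>\<le>\<^sub>0 \<Longrightarrow> d \<le> dist z x"
    using separate_point_closed [OF closed_nonpos_Reals_complex assms] by blast
  moreover have "d \<le> cmod (z + of_real t)" if "t \<ge> 0" for t
    using d(2) [of "- of_real t"] that by (simp add: dist_norm complex_nonpos_Reals_iff)
  ultimately show ?thesis using that by blast
qed

lemma nonpos_Reals_add_neq_0:
  assumes "z \<notin> \<real>\<^sub>\<le>\<^sub>0" "t \<ge> 0"
  shows "z + complex_of_real t \<noteq> 0"
  using assms by (auto simp: complex_nonpos_Reals_iff add_eq_0_iff2)

text \<open>\<open>e\<^bsup>-t\<^esup> dt\<close> is a probability measure on the half-line, so averaging against it preserves bounds.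
  The estimate carries both the integrability of the kernels and the differentiation under the
  integral sign.\<close>
lemma set_integrable_exp_neg_mult:
  fixes k :: "real \<Rightarrow> complex"
  assumes cont: "continuous_on {0..} k" and bd: "\<And>t. t \<ge> 0 \<Longrightarrow> cmod (k t) \<le> B"
  shows "set_integrable lborel {0..} (\<lambda>t. of_real (exp (- t)) * k t)"
    and "cmod (LINT t:{0..}|lborel. of_real (exp (- t)) * k t) \<le> B"
proof -
  have i: "set_integrable lborel {0..} (\<lambda>t::real. B * exp (- t))"
    by (intro set_integrable_mult_right set_integrable_exp_neg)
  have b: "norm (of_real (exp (- t)) * k t) \<le> B * exp (- t)" if "t \<ge> 0" for t
    using bd [OF that] by (simp add: norm_mult mult.commute)
  have "continuous_on {0..} (\<lambda>t. of_real (exp (- t)) * k t)"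
    by (intro continuous_intros cont)
  then have m: "set_borel_measurable lborel {0..} (\<lambda>t. of_real (exp (- t)) * k t)"
    using set_measurable_continuous_on [of "{0::real..}"] by (simp add: set_borel_measurable_def)
  show s: "set_integrable lborel {0..} (\<lambda>t. of_real (exp (- t)) * k t)"
    by (rule set_integrable_bound [OF i m])
       (auto intro!: AE_I2 order_trans [OF b order_trans [OF abs_ge_self]])
  have "cmod (LINT t:{0..}|lborel. of_real (exp (- t)) * k t) \<le> (LINT t:{0..}|lborel. B * exp (- t))"
    using s i b unfolding set_lebesgue_integral_def set_integrable_def
    by (intro Bochner_Integration.integral_norm_bound_integral) (auto simp: indicator_def)
  then show "cmod (LINT t:{0..}|lborel. of_real (exp (- t)) * k t) \<le> B"
    by (simp add: set_integral_exp_neg)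
qed

lemma set_integrable_exp_stieltjes:
  fixes z :: complex
  assumes "z \<notin> \<real>\<^sub>\<le>\<^sub>0"
  shows "set_integrable lborel {0..} (\<lambda>t. of_real (exp (- t)) / (z + of_real t) ^ n)"
proof -
  obtain d where d: "d > 0" "\<And>t. t \<ge> 0 \<Longrightarrow> d \<le> cmod (z + of_real t)"
    using nonpos_Reals_dist_bound [OF assms] by blast
  have "set_integrable lborel {0..} (\<lambda>t. of_real (exp (- t)) * (1 / (z + of_real t) ^ n))"
  proof (rule set_integrable_exp_neg_mult)
    show "continuous_on {0..} (\<lambda>t. 1 / (z + complex_of_real t) ^ n)"
      using nonpos_Reals_add_neq_0 [OF assms] by (intro continuous_intros) auto
    show "cmod (1 / (z + complex_of_real t) ^ n) \<le> 1 / d ^ n" if "t \<ge> 0" for t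
      using d that by (simp add: norm_divide norm_power frac_le power_mono)
  qed
  then show ?thesis by simp
qed

text \<open>The boundary term of integrating \<open>d/dt (e\<^bsup>-t\<^esup> (z + t)\<^bsup>-n\<^esup>)\<close> over the half-line is \<open>- z\<^bsup>-n\<^esup>\<close>. The
  case \<open>n = 1\<close> expresses the derivative of the first transform through the transform itself, and
  the case \<open>n = 2\<close> is used to find the sign of the derivative of \<open>critical_fun\<close>.\<close>
lemma exp_stieltjes_Suc:
  assumes "z \<notin> \<real>\<^sub>\<le>\<^sub>0"
  shows "of_nat n * exp_stieltjes (Suc n) z = 1 / z ^ n - exp_stieltjes n z"
proof -
  obtain d where d: "d > 0" "\<And>t. t \<ge> 0 \<Longrightarrow> d \<le> cmod (z + of_real t)"
    using nonpos_Reals_dist_bound [OF assms] by blast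
  note nz = nonpos_Reals_add_neq_0 [OF assms]
  let ?f = "\<lambda>n t. of_real (exp (- t)) / (z + complex_of_real t) ^ n"
  have "(LINT t:{0..}|lborel. - ?f n t - of_nat n * ?f (Suc n) t) = 0 - ?f n 0"
  proof (rule set_integral_FTC_atLeast_0)
    fix t :: real assume t: "t \<ge> 0"
    have E: "exp (- complex_of_real t) = of_real (exp (- t))" for t
      using exp_of_real [of "- t", where 'a = complex] by simp
    have "((\<lambda>w. exp (- w) / (z + w) ^ n) has_field_derivative
        (- ?f n t - of_nat n * ?f (Suc n) t)) (at (of_real t))"
    proof -
      have D: "((\<lambda>w. exp (- w) * inverse (z + w) ^ n) has_field_derivative
          (- exp (- of_real t) * inverse (z + of_real t) ^ n
           + exp (- of_real t) * (of_nat n * inverse (z + of_real t) ^ (n - 1)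
               * (- (inverse (z + of_real t))\<^sup>2)))) (at (of_real t))"
        using nz [OF t]
        by (auto intro!: derivative_eq_intros simp: power2_eq_square)
      have X: "of_nat n * inverse (z + of_real t) ^ (n - 1) * (- (inverse (z + of_real t))\<^sup>2)
          = - of_nat n * inverse (z + of_real t) ^ Suc n"
        by (cases n) (auto simp: power2_eq_square algebra_simps)
      show ?thesis
        using D unfolding X E by (simp add: divide_inverse power_inverse mult_ac del: power_Suc)
    qed
    then have "((\<lambda>t. exp (- of_real t) / (z + of_real t) ^ n) has_vector_derivative
        (- ?f n t - of_nat n * ?f (Suc n) t)) (at t)"
      using has_vector_derivative_real_field by blast
    then show "(?f n has_vector_derivative (- ?f n t - of_nat n * ?f (Suc n) t)) (at t)"
      by (simp add: E)
    show "isCont (\<lambda>t. - ?f n t - of_nat n * ?f (Suc n) t) t"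
      using nz [OF t] by (intro continuous_intros) auto
  next
    have "set_integrable lborel {0..} (\<lambda>t. (- 1) * ?f n t - of_nat n * ?f (Suc n) t)"
      by (intro set_integral_diff set_integrable_mult_right set_integrable_exp_stieltjes assms)
    then show "set_integrable lborel {0..} (\<lambda>t. - ?f n t - of_nat n * ?f (Suc n) t)"
      by simp
    have "((\<lambda>t::real. exp (- t) / d ^ n) \<longlongrightarrow> 0) at_top"
      by (rule tendsto_divide_zero [OF tendsto_exp_neg_at_top])
    moreover have "\<forall>\<^sub>F t in at_top. cmod (?f n t) \<le> exp (- t) / d ^ n"
      using eventually_ge_at_top [of 0]
      by eventually_elim
         (use d in \<open>force simp: norm_divide norm_power intro!: frac_le power_mono\<close>)
    ultimately show "(?f n \<longlongrightarrow> 0) at_top"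
      by (rule Lim_null_comparison [rotated])
  qed
  moreover have "(LINT t:{0..}|lborel. (- 1) * ?f n t - of_nat n * ?f (Suc n) t) =
     (- 1) * exp_stieltjes n z - of_nat n * exp_stieltjes (Suc n) z"
    unfolding exp_stieltjes_def
    by (subst set_integral_diff, intro set_integrable_mult_right set_integrable_exp_stieltjes assms,
        intro set_integrable_mult_right set_integrable_exp_stieltjes assms,
        simp only: set_integral_mult_right)
  ultimately show ?thesis
    by (simp add: algebra_simps)
qed

text \<open>For \<open>a = w + t\<close> and \<open>b = z + t\<close>, this is the error of the linearisation of the kernel
  \<open>e / (z + t)\<close>; the factor \<open>a - b = w - z\<close> on the right makes it vanish in the limit, uniformly in
  \<open>t\<close>.\<close>
lemma difference_quotient_remainder:
  fixes a b e :: "'a::field"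
  assumes "a \<noteq> 0" "b \<noteq> 0" "a \<noteq> b"
  shows "(e / a - e / b) / (a - b) + e / b\<^sup>2 = e * ((a - b) / (a * b\<^sup>2))"
proof -
  have "e / a - e / b = (a - b) * (- e / (a * b))"
    using assms by (simp add: field_simps)
  then have "(e / a - e / b) / (a - b) = - e / (a * b)"
    using assms by simp
  then show ?thesis
    using assms by (simp add: field_simps power2_eq_square)
qed

lemma exp_stieltjes_has_field_derivative:
  assumes "z \<notin> \<real>\<^sub>\<le>\<^sub>0"
  shows "(exp_stieltjes 1 has_field_derivative - exp_stieltjes 2 z) (at z)"
proof -
  obtain d where d: "d > 0" "\<And>t. t \<ge> 0 \<Longrightarrow> d \<le> cmod (z + of_real t)"
    using nonpos_Reals_dist_bound [OF assms] by blast
  note nz = nonpos_Reals_add_neq_0 [OF assms]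
  let ?f = "\<lambda>n z t. of_real (exp (- t)) / (z + complex_of_real t) ^ n"
  have est: "cmod ((exp_stieltjes 1 w - exp_stieltjes 1 z) / (w - z) - - exp_stieltjes 2 z)
       \<le> 2 / d ^ 3 * cmod (w - z)" if w: "w \<noteq> z" "dist w z < d / 2" for w
  proof -
    \<comment> \<open>halving the distance keeps all nearby \<open>w\<close> uniformly away from the slit\<close>
    have wd: "d / 2 \<le> cmod (w + of_real t)" if "t \<ge> 0" for t
    proof -
      have "cmod (z + of_real t) \<le> cmod (w + of_real t) + cmod (w - z)"
        using norm_triangle_ineq4 [of "w + of_real t" "w - z"] by (simp add: add.commute)
      then show ?thesis
        using d(2) [OF that] w(2) by (simp add: dist_norm)
    qed
    have w0: "w \<notin> \<real>\<^sub>\<le>\<^sub>0"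
    proof
      assume "w \<in> \<real>\<^sub>\<le>\<^sub>0"
      then have "w + of_real (- Re w) = 0" "- Re w \<ge> 0"
        by (auto simp: complex_nonpos_Reals_iff complex_eq_iff)
      then show False using wd [of "- Re w"] d(1) by simp
    qed
    note nw = nonpos_Reals_add_neq_0 [OF w0]
    let ?k = "\<lambda>t. (w - z) / ((w + complex_of_real t) * (z + of_real t)\<^sup>2)"
    have i: "set_integrable lborel {0..} (\<lambda>t. ?f n z t)" "set_integrable lborel {0..} (\<lambda>t. ?f n w t)" for n
      using set_integrable_exp_stieltjes [OF assms] set_integrable_exp_stieltjes [OF w0] by auto
    have "(exp_stieltjes 1 w - exp_stieltjes 1 z) / (w - z) + exp_stieltjes 2 z
        = (LINT t:{0..}|lborel. (?f 1 w t - ?f 1 z t) / (w - z) + ?f 2 z t)"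
      unfolding exp_stieltjes_def
      by (subst set_integral_add, intro set_integrable_divide set_integral_diff i, rule i,
          subst set_integral_divide_zero, subst set_integral_diff, rule i, rule i, rule refl)
    also have "\<dots> = (LINT t:{0..}|lborel. of_real (exp (- t)) * ?k t)"
    proof (intro set_lebesgue_integral_cong allI impI)
      fix t :: real assume "t \<in> {0..}"
      then have "w + of_real t \<noteq> 0" "z + of_real t \<noteq> 0"
        using nw nz by auto
      then show "(?f 1 w t - ?f 1 z t) / (w - z) + ?f 2 z t = of_real (exp (- t)) * ?k t"
        using w(1) difference_quotient_remainder [of "w + of_real t" "z + of_real t" "of_real (exp (- t))"]
        by simp
    qed simp
    also have "cmod \<dots> \<le> cmod (w - z) / (d / 2 * d\<^sup>2)"
    proof (rule set_integrable_exp_neg_mult)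
      show "continuous_on {0..} ?k"
        using nz nw by (intro continuous_intros) auto
      show "cmod (?k t) \<le> cmod (w - z) / (d / 2 * d\<^sup>2)" if "t \<ge> 0" for t
      proof -
        have "d / 2 * d\<^sup>2 \<le> cmod (w + of_real t) * (cmod (z + of_real t))\<^sup>2"
          using d that by (intro mult_mono power_mono wd) auto
        then have "cmod (w - z) / (cmod (w + of_real t) * (cmod (z + of_real t))\<^sup>2)
            \<le> cmod (w - z) / (d / 2 * d\<^sup>2)"
          using d(1) by (intro frac_le) auto
        then show ?thesis
          by (simp only: norm_divide norm_mult norm_power)
      qed
    qed
    finally show ?thesis
      by (simp add: field_simps power2_eq_square power3_eq_cube)
  qed
  have "((\<lambda>w. 2 / d ^ 3 * cmod (w - z)) \<longlongrightarrow> 2 / d ^ 3 * cmod (z - z)) (at z)"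
    by (intro tendsto_intros)
  then have lim: "((\<lambda>w. 2 / d ^ 3 * cmod (w - z)) \<longlongrightarrow> 0) (at z)"
    by simp
  have "\<forall>\<^sub>F w in at z. cmod ((exp_stieltjes 1 w - exp_stieltjes 1 z) / (w - z) - - exp_stieltjes 2 z)
       \<le> 2 / d ^ 3 * cmod (w - z)"
    using est d(1) unfolding eventually_at by (intro exI [of _ "d / 2"]) auto
  then have "((\<lambda>w. (exp_stieltjes 1 w - exp_stieltjes 1 z) / (w - z) - - exp_stieltjes 2 z) \<longlongrightarrow> 0) (at z)"
    by (rule Lim_null_comparison [OF _ lim])
  then show ?thesis
    unfolding has_field_derivative_iff by (rule LIM_zero_cancel)
qed

section \<open>The differential equation\<close>

lemma H_alpha_eq: "H_alpha \<alpha> z = z - of_real \<alpha> * z * exp_stieltjes 1 (- z)"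
proof -
  have "(LINT t:{0..}|lborel. of_real (exp (- t)) / (z - of_real t))
      = (LINT t:{0..}|lborel. (- 1) * (of_real (exp (- t)) / (- z + of_real t) ^ 1))"
  proof (intro set_lebesgue_integral_cong allI impI)
    show "complex_of_real (exp (- t)) / (z - of_real t)
        = (- 1) * (of_real (exp (- t)) / (- z + of_real t) ^ 1)" for t
      using minus_divide_right [of "complex_of_real (exp (- t))" "of_real t - z"] by simp
  qed simp
  also have "\<dots> = - exp_stieltjes 1 (- z)"
    unfolding exp_stieltjes_def by (subst set_integral_mult_right) simp
  finally show ?thesis
    unfolding H_alpha_def by simp
qed

text \<open>With \<open>E\<^sub>2 = 1/z - E\<^sub>1\<close>, differentiating \<open>z - \<alpha> z E\<^sub>1(-z)\<close> produces no new transcendental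
  function.\<close>
lemma H_alpha_has_field_derivative:
  assumes "z \<in> - complex_of_real ` {0..}"
  shows "(H_alpha \<alpha> has_field_derivative (of_real \<alpha> + z + (inverse z - 1) * H_alpha \<alpha> z)) (at z)"
proof -
  have z: "- z \<notin> \<real>\<^sub>\<le>\<^sub>0"
    using assms by (auto simp: complex_nonpos_Reals_iff complex_eq_iff image_iff)
  have z0: "z \<noteq> 0"
    using assms by force
  have E2: "exp_stieltjes 2 (- z) = 1 / (- z) - exp_stieltjes 1 (- z)"
    using exp_stieltjes_Suc [OF z, of 1] by (simp add: numeral_2_eq_2)
  have "(uminus has_field_derivative - 1) (at z)"
    by (auto intro!: derivative_eq_intros)
  then have D: "((\<lambda>z. exp_stieltjes 1 (- z)) has_field_derivative - exp_stieltjes 2 (- z) * - 1) (at z)"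
    using exp_stieltjes_has_field_derivative [OF z] by (rule DERIV_chain2 [rotated])
  have "((\<lambda>z. z - of_real \<alpha> * z * exp_stieltjes 1 (- z)) has_field_derivative
      (1 - (of_real \<alpha> * 1 * exp_stieltjes 1 (- z)
        + - exp_stieltjes 2 (- z) * - 1 * (of_real \<alpha> * z)))) (at z)"
    by (intro DERIV_diff DERIV_mult DERIV_cmult DERIV_ident D)
  moreover have "1 - (of_real \<alpha> * 1 * exp_stieltjes 1 (- z)
        + - exp_stieltjes 2 (- z) * - 1 * (of_real \<alpha> * z))
      = of_real \<alpha> + z + (inverse z - 1) * H_alpha \<alpha> z"
    unfolding E2 H_alpha_eq using z0 by (simp add: field_simps)
  ultimately show ?thesis
    unfolding H_alpha_eq [abs_def] by simp
qed

section \<open>The transform on the positive axis\<close>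

definition exp_stieltjes_real :: "real \<Rightarrow> real" where
  "exp_stieltjes_real c = (LINT t:{0..}|lborel. exp (- t) / (c + t))"

lemma exp_stieltjes_of_real:
  "exp_stieltjes n (of_real c) = of_real (LINT t:{0..}|lborel. exp (- t) / (c + t) ^ n)"
  unfolding exp_stieltjes_def set_integral_complex_of_real [symmetric] by simp

lemma exp_stieltjes_1_of_real: "exp_stieltjes 1 (of_real c) = of_real (exp_stieltjes_real c)"
  unfolding exp_stieltjes_of_real exp_stieltjes_real_def by simp

lemma of_real_notin_nonpos: "c > 0 \<Longrightarrow> complex_of_real c \<notin> \<real>\<^sub>\<le>\<^sub>0"
  by (simp add: complex_nonpos_Reals_iff)

lemma exp_stieltjes_2_of_real:
  assumes "c > 0" shows "exp_stieltjes 2 (of_real c) = of_real (1 / c - exp_stieltjes_real c)"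
  using exp_stieltjes_Suc [OF of_real_notin_nonpos [OF assms], of 1]
  by (simp add: exp_stieltjes_1_of_real del: One_nat_def)

lemma exp_stieltjes_3_of_real:
  assumes "c > 0" shows "exp_stieltjes 3 (of_real c) = of_real ((1 / c\<^sup>2 - 1 / c + exp_stieltjes_real c) / 2)"
  using exp_stieltjes_Suc [OF of_real_notin_nonpos [OF assms], of 2] assms
  by (simp add: exp_stieltjes_2_of_real eq_divide_eq mult.commute)

lemma exp_stieltjes_real_DERIV:
  assumes "c > 0"
  shows "(exp_stieltjes_real has_real_derivative exp_stieltjes_real c - 1 / c) (at c)"
proof -
  have "((\<lambda>x. exp_stieltjes 1 (of_real x)) has_vector_derivative - exp_stieltjes 2 (of_real c)) (at c)"
    by (rule has_vector_derivative_real_field exp_stieltjes_has_field_derivative of_real_notin_nonpos assms)+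
  then have "((\<lambda>x. Re (exp_stieltjes 1 (of_real x))) has_vector_derivative
       Re (- exp_stieltjes 2 (of_real c))) (at c)"
    by (rule bounded_linear.has_vector_derivative [OF bounded_linear_Re])
  then show ?thesis
    using assms by (simp add: exp_stieltjes_1_of_real exp_stieltjes_2_of_real
        has_real_derivative_iff_has_vector_derivative del: One_nat_def)
qed

text \<open>Splitting \<open>t = (c + t) - c\<close> in the numerator reduces the integrals with a factor \<open>t\<close> to the
  transforms.\<close>
lemma moment_kernel_integral:
  assumes "c > 0"
  shows "of_real (LINT t:{0..}|lborel. t * exp (- t) / (c + t) ^ Suc n)
       = exp_stieltjes n (of_real c) - of_real c * exp_stieltjes (Suc n) (of_real c)"
    and "set_integrable lborel {0..} (\<lambda>t. t * exp (- t) / (c + t) ^ Suc n)"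
proof -
  let ?f = "\<lambda>n t. of_real (exp (- t)) / (complex_of_real c + of_real t) ^ n"
  note i = set_integrable_exp_stieltjes [OF of_real_notin_nonpos [OF assms]]
  have eq: "complex_of_real (t * exp (- t) / (c + t) ^ Suc n) = ?f n t - of_real c * ?f (Suc n) t"
    if "t \<in> {0..}" for t
  proof -
    define b where "b = complex_of_real c + of_real t"
    have "b \<noteq> 0" and t: "complex_of_real t = b - of_real c"
      unfolding b_def using nonpos_Reals_add_neq_0 [OF of_real_notin_nonpos [OF assms]] that by auto
    then show ?thesis
      by (simp add: t left_diff_distrib diff_divide_distrib flip: b_def)
  qed
  have "of_real (LINT t:{0..}|lborel. t * exp (- t) / (c + t) ^ Suc n) =
     (LINT t:{0..}|lborel. complex_of_real (t * exp (- t) / (c + t) ^ Suc n))"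
    by (rule set_integral_complex_of_real [symmetric])
  also have "\<dots> = (LINT t:{0..}|lborel. ?f n t - of_real c * ?f (Suc n) t)"
    by (rule set_lebesgue_integral_cong) (use eq in \<open>auto\<close>)
  also have "\<dots> = exp_stieltjes n (of_real c) - of_real c * exp_stieltjes (Suc n) (of_real c)"
    unfolding exp_stieltjes_def
    by (subst set_integral_diff, rule i, rule set_integrable_mult_right, rule i,
        subst set_integral_mult_right, rule refl)
  finally show "of_real (LINT t:{0..}|lborel. t * exp (- t) / (c + t) ^ Suc n)
       = exp_stieltjes n (of_real c) - of_real c * exp_stieltjes (Suc n) (of_real c)" .
  have "set_integrable lborel {0..} (\<lambda>t. ?f n t - of_real c * ?f (Suc n) t)"
    by (intro set_integral_diff set_integrable_mult_right i)
  then have "set_integrable lborel {0..} (\<lambda>t. complex_of_real (t * exp (- t) / (c + t) ^ Suc n))"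
    by (subst set_integrable_cong [OF refl refl eq])
  then have "integrable lborel (\<lambda>t. complex_of_real (indicator {0..} t *\<^sub>R (t * exp (- t) / (c + t) ^ Suc n)))"
    unfolding set_integrable_def by (simp add: scaleR_conv_of_real)
  then show "set_integrable lborel {0..} (\<lambda>t. t * exp (- t) / (c + t) ^ Suc n)"
    unfolding set_integrable_def complex_of_real_integrable_eq .
qed

lemma critical_integral_eq:
  assumes "c > 0"
  shows "(LINT t:{0..}|lborel. t * exp (- t) / (c + t)\<^sup>2) = (1 + c) * exp_stieltjes_real c - 1"
proof -
  have "complex_of_real (LINT t:{0..}|lborel. t * exp (- t) / (c + t)\<^sup>2)
      = of_real (exp_stieltjes_real c - c * (1 / c - exp_stieltjes_real c))"
    using moment_kernel_integral(1) [OF assms, of 1]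
    by (simp add: exp_stieltjes_1_of_real exp_stieltjes_2_of_real assms flip: numeral_2_eq_2 One_nat_def)
  then show ?thesis
    using assms unfolding of_real_eq_iff by (simp add: right_diff_distrib distrib_right)
qed

text \<open>Twice the positive integral of \<open>t e\<^bsup>-t\<^esup> / (c + t)\<^sup>3\<close> equals the difference of the two sides, by the
  recurrence for \<open>n = 1\<close> and \<open>n = 2\<close>. This is the inequality that makes \<open>critical_fun\<close> decrease.\<close>
lemma exp_stieltjes_real_less:
  assumes "c > 0"
  shows "(2 + c) * exp_stieltjes_real c < 1 / c + 1"
proof -
  have "complex_of_real (LINT t:{0..}|lborel. t * exp (- t) / (c + t) ^ 3)
      = of_real (1 / c - exp_stieltjes_real c - c * ((1 / c\<^sup>2 - 1 / c + exp_stieltjes_real c) / 2))"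
    using moment_kernel_integral(1) [OF assms, of 2]
    by (simp add: exp_stieltjes_2_of_real exp_stieltjes_3_of_real assms flip: numeral_3_eq_3 One_nat_def)
  then have "(LINT t:{0..}|lborel. t * exp (- t) / (c + t) ^ 3) =
     1 / c - exp_stieltjes_real c - c * ((1 / c\<^sup>2 - 1 / c + exp_stieltjes_real c) / 2)"
    unfolding of_real_eq_iff .
  moreover have "0 < (LINT t:{0..}|lborel. t * exp (- t) / (c + t) ^ 3)"
  proof -
    let ?f = "\<lambda>t. indicator {0..} t *\<^sub>R (t * exp (- t) / (c + t) ^ 3)"
    have i: "integrable lborel ?f"
      using moment_kernel_integral(2) [OF assms, of 2]
      by (simp add: set_integrable_def flip: numeral_3_eq_3)
    have nn: "AE t in lborel. 0 \<le> ?f t"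
      using assms by (auto intro!: AE_I2 simp: indicator_def)
    have "\<not> (AE t in lborel. ?f t = 0)"
    proof
      assume "AE t in lborel. ?f t = 0"
      then have "AE t in lborel. t \<notin> {1..2::real}"
        by eventually_elim (use assms in \<open>auto simp: indicator_def split: if_splits\<close>)
      then have "emeasure lborel {1..2::real} = 0"
        by (subst (asm) AE_iff_measurable [where N = "{1..2}"]) auto
      then show False by simp
    qed
    then have "(LINT t|lborel. ?f t) \<noteq> 0" "(LINT t|lborel. ?f t) \<ge> 0"
      using integral_nonneg_eq_0_iff_AE [OF i nn] integral_nonneg_AE [OF nn] by auto
    then show ?thesis
      by (simp add: set_lebesgue_integral_def)
  qed
  moreover have "c * ((1 / c\<^sup>2 - 1 / c + exp_stieltjes_real c) / 2)
      = (1 / c - 1 + c * exp_stieltjes_real c) / 2"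
    using assms by (simp add: power2_eq_square distrib_left right_diff_distrib)
  ultimately show ?thesis
    by (simp add: distrib_right)
qed

section \<open>The critical point\<close>

text \<open>The closed form of \<open>\<integral>\<^sub>0\<^sup>\<infinity> t e\<^bsup>-t\<^esup> / (c + t)\<^sup>2 dt\<close> found in \<open>critical_integral_eq\<close>.\<close>
definition critical_fun :: "real \<Rightarrow> real" where
  "critical_fun c = (1 + c) * exp_stieltjes_real c - 1"

lemma critical_fun_DERIV:
  assumes "c > 0"
  shows "(critical_fun has_real_derivative (2 + c) * exp_stieltjes_real c - 1 / c - 1) (at c)"
proof -
  have "((\<lambda>c. (1 + c) * exp_stieltjes_real c - 1) has_real_derivative
      (0 + 1) * exp_stieltjes_real c + (exp_stieltjes_real c - 1 / c) * (1 + c) - 0) (at c)"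
    by (intro DERIV_diff DERIV_mult DERIV_add DERIV_const DERIV_ident exp_stieltjes_real_DERIV assms)
  moreover have "(0 + 1) * exp_stieltjes_real c + (exp_stieltjes_real c - 1 / c) * (1 + c) - 0
      = (2 + c) * exp_stieltjes_real c - 1 / c - 1"
    using assms by (simp add: field_simps)
  ultimately show ?thesis
    unfolding critical_fun_def [abs_def] by simp
qed

lemma critical_fun_less:
  assumes "0 < a" "a < b"
  shows "critical_fun b < critical_fun a"
proof (rule DERIV_neg_imp_decreasing [OF assms(2)])
  fix x assume "a \<le> x"
  then have "x > 0" using assms by simp
  then show "\<exists>y. (critical_fun has_real_derivative y) (at x) \<and> y < 0"
    using critical_fun_DERIV [of x] exp_stieltjes_real_less [of x] by force
qed

lemma critical_fun_less_iff:
  "a > 0 \<Longrightarrow> b > 0 \<Longrightarrow> critical_fun a < critical_fun b \<longleftrightarrow> b < a"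
  using critical_fun_less by (metis less_asym' linorder_neqE_linordered_idom)

lemma critical_fun_less_inverse:
  assumes "c > 0"
  shows "critical_fun c < 1 / c"
proof -
  have "exp_stieltjes_real c < (1 / c + 1) / (2 + c)"
    using exp_stieltjes_real_less [OF assms] assms by (simp add: less_divide_eq mult.commute)
  then have "(1 + c) * exp_stieltjes_real c < (1 + c) * ((1 / c + 1) / (2 + c))"
    using assms by (intro mult_strict_left_mono) auto
  also have "\<dots> = (1 + c)\<^sup>2 / (c * (2 + c))"
    using assms by (simp add: field_simps power2_eq_square)
  also have "\<dots> = 1 + 1 / (c * (2 + c))"
    using assms by (simp add: divide_simps) (simp add: algebra_simps power2_eq_square)
  also have "1 / (c * (2 + c)) \<le> 1 / c"
    using assms mult_left_mono [of 1 "2 + c" c] by (intro frac_le) auto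
  finally show ?thesis
    by (simp add: critical_fun_def)
qed

text \<open>The function blows up logarithmically at \<open>0\<close>. Instead of estimating the integral, the equation
  \<open>E\<^sub>1' = E\<^sub>1 - 1/x\<close> suffices: \<open>e\<^bsup>-x\<^esup> E\<^sub>1(x)\<close> has derivative \<open>- e\<^bsup>-x\<^esup> / x \<le> - e\<^bsup>-1\<^esup> / x\<close> on \<open>(0, 1]\<close>, so adding
  \<open>e\<^bsup>-1\<^esup> ln x\<close> leaves a nonincreasing function that is nonnegative at \<open>1\<close>.\<close>
lemma critical_fun_ge_ln:
  assumes "0 < c" "c \<le> 1"
  shows "- exp (- 1) * ln c - 1 \<le> critical_fun c"
proof -
  have nonneg: "exp_stieltjes_real x \<ge> 0" if "x > 0" for x
    unfolding exp_stieltjes_real_def set_lebesgue_integral_def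
    using that by (intro integral_nonneg_AE) (auto simp: indicator_def)
  let ?f = "\<lambda>x. exp (- x) * exp_stieltjes_real x + exp (- 1) * ln x"
  have "?f 1 \<le> ?f c"
  proof (rule DERIV_nonpos_imp_nonincreasing [OF assms(2)])
    fix x assume x: "c \<le> x" "x \<le> 1"
    have "(?f has_real_derivative (exp (- 1) - exp (- x)) / x) (at x)"
      using assms x
      by (auto intro!: derivative_eq_intros exp_stieltjes_real_DERIV simp: field_simps)
    moreover have "(exp (- 1) - exp (- x)) / x \<le> 0"
      using assms x by (intro divide_nonpos_pos) auto
    ultimately show "\<exists>y. (?f has_real_derivative y) (at x) \<and> y \<le> 0"
      by blast
  qed
  moreover have "?f 1 \<ge> 0"
    using nonneg [of 1] by simp
  moreover have "exp (- c) * exp_stieltjes_real c \<le> 1 * exp_stieltjes_real c"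
    using nonneg [OF assms(1)] assms by (intro mult_right_mono) auto
  moreover have "exp_stieltjes_real c \<le> (1 + c) * exp_stieltjes_real c"
    using nonneg [OF assms(1)] assms by (simp add: algebra_simps)
  ultimately show ?thesis
    by (simp add: critical_fun_def)
qed

lemma critical_fun_surj:
  assumes "y > 0"
  obtains c where "c > 0" "critical_fun c = y"
proof -
  \<comment> \<open>\<open>a\<close> and \<open>b\<close> are the points where the lower bound \<open>critical_fun_ge_ln\<close> and the upper bound
    \<open>critical_fun_less_inverse\<close> reach the level \<open>y\<close>\<close>
  define a where "a = exp (- (exp 1 * (1 + y)))"
  define b where "b = 1 / y"
  have a: "0 < a" "a \<le> 1"
    using assms by (auto simp: a_def)
  have "- exp (- 1) * ln a - 1 = (exp (- 1) * exp 1) * (1 + y) - 1"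
    by (simp add: a_def algebra_simps)
  also have "exp (- 1) * exp 1 = (1 :: real)"
    by (simp flip: exp_add)
  finally have "- exp (- 1) * ln a - 1 = y"
    by simp
  then have fa: "y \<le> critical_fun a"
    using critical_fun_ge_ln [OF a] by simp
  have b: "b > 0" "critical_fun b < y"
    using assms critical_fun_less_inverse [of b] by (auto simp: b_def)
  have "a < b"
    using critical_fun_less_iff [OF b(1) a(1)] fa b(2) by simp
  moreover have "continuous_on {a..b} critical_fun"
    using a(1) by (intro DERIV_continuous_on [OF DERIV_subset [OF critical_fun_DERIV]]) auto
  ultimately obtain c where "a \<le> c" "critical_fun c = y"
    using IVT2' [of critical_fun b y a] fa b by auto
  then show ?thesis using that [of c] a by linarith
qed

lemma c_alpha:
  assumes "\<alpha> > 0"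
  shows c_alpha_pos: "c_alpha \<alpha> > 0" and critical_fun_c_alpha: "critical_fun (c_alpha \<alpha>) = 1 / \<alpha>"
proof -
  have "\<exists>!c. 0 < c \<and> critical_fun c = 1 / \<alpha>"
  proof (rule ex_ex1I)
    show "\<exists>c. 0 < c \<and> critical_fun c = 1 / \<alpha>"
      using critical_fun_surj [of "1 / \<alpha>"] assms by auto
    show "c = c'" if "0 < c \<and> critical_fun c = 1 / \<alpha>" "0 < c' \<and> critical_fun c' = 1 / \<alpha>" for c c'
      using critical_fun_less_iff [of c c'] critical_fun_less_iff [of c' c] that by force
  qed
  moreover have "c_alpha \<alpha> = (THE c. 0 < c \<and> critical_fun c = 1 / \<alpha>)"
    unfolding c_alpha_def using critical_integral_eq by (metis critical_fun_def)
  ultimately show "c_alpha \<alpha> > 0" "critical_fun (c_alpha \<alpha>) = 1 / \<alpha>"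
    using theI' [of "\<lambda>c. 0 < c \<and> critical_fun c = 1 / \<alpha>"] by auto
qed

text \<open>Solving the defining equation for the transform: from here on it can be eliminated in favour
  of a rational function of \<open>\<alpha>\<close> and \<open>c\<^sub>\<alpha>\<close>.\<close>
lemma exp_stieltjes_real_c_alpha:
  assumes "\<alpha> > 0"
  shows "exp_stieltjes_real (c_alpha \<alpha>) = (1 + \<alpha>) / (\<alpha> * (1 + c_alpha \<alpha>))"
proof -
  have "(1 + c_alpha \<alpha>) * exp_stieltjes_real (c_alpha \<alpha>) = (1 + \<alpha>) / \<alpha>"
    using critical_fun_c_alpha [OF assms] assms by (simp add: critical_fun_def add_divide_distrib)
  then have "exp_stieltjes_real (c_alpha \<alpha>) * (\<alpha> * (1 + c_alpha \<alpha>)) = (1 + \<alpha>) / \<alpha> * \<alpha>"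
    by (simp only: mult_ac)
  then show ?thesis
    using c_alpha_pos [OF assms] assms by (intro eq_divide_imp) auto
qed

lemma critical_fun_deriv_c_alpha:
  assumes "\<alpha> > 0"
  defines "c \<equiv> c_alpha \<alpha>"
  shows "(2 + c) * exp_stieltjes_real c - 1 / c - 1 = (2 * c + c\<^sup>2 - \<alpha>) / (\<alpha> * c * (1 + c))"
  using c_alpha_pos [OF assms(1)] assms(1)
  unfolding c_def exp_stieltjes_real_c_alpha [OF assms(1)]
  by (simp add: divide_simps) (simp add: algebra_simps power2_eq_square)

text \<open>The negativity of the derivative of \<open>critical_fun\<close>, evaluated at \<open>c\<^sub>\<alpha>\<close>.\<close>
lemma c_alpha_less:
  assumes "\<alpha> > 0"
  shows "2 * c_alpha \<alpha> + (c_alpha \<alpha>)\<^sup>2 < \<alpha>"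
proof -
  let ?c = "c_alpha \<alpha>"
  have "(2 * ?c + ?c\<^sup>2 - \<alpha>) / (\<alpha> * ?c * (1 + ?c)) < 0"
    using exp_stieltjes_real_less [OF c_alpha_pos [OF assms]] critical_fun_deriv_c_alpha [OF assms] by simp
  moreover have "\<alpha> * ?c * (1 + ?c) > 0"
    using assms c_alpha_pos [OF assms] by simp
  ultimately show ?thesis
    by (simp add: divide_less_0_iff)
qed

section \<open>The critical value and the second derivative\<close>

lemma s_alpha_eq:
  assumes "\<alpha> > 0"
  shows "s_alpha \<alpha> = c_alpha \<alpha> / (1 + c_alpha \<alpha>) * (\<alpha> - c_alpha \<alpha>)"
proof -
  let ?c = "c_alpha \<alpha>"
  have "complex_of_real (s_alpha \<alpha>) = of_real (- ?c + \<alpha> * ?c * exp_stieltjes_real ?c)"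
    unfolding of_real_s_alpha H_alpha_eq by (simp add: exp_stieltjes_1_of_real del: One_nat_def)
  then have "s_alpha \<alpha> = - ?c + \<alpha> * ?c * exp_stieltjes_real ?c"
    unfolding of_real_eq_iff .
  then show ?thesis
    unfolding exp_stieltjes_real_c_alpha [OF assms]
    using assms c_alpha_pos [OF assms] by (simp add: divide_simps) (simp add: algebra_simps)
qed

lemma s_alpha_gt_c_alpha_squared:
  assumes "\<alpha> > 0"
  shows "(c_alpha \<alpha>)\<^sup>2 < s_alpha \<alpha>"
proof -
  let ?c = "c_alpha \<alpha>"
  have "?c * (?c * (1 + ?c)) < ?c * (\<alpha> - ?c)"
    using c_alpha_less [OF assms] c_alpha_pos [OF assms]
    by (intro mult_strict_left_mono) (auto simp: power2_eq_square algebra_simps)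
  then show ?thesis
    unfolding s_alpha_eq [OF assms] using c_alpha_pos [OF assms]
    by (simp add: less_divide_eq power2_eq_square mult_ac)
qed

text \<open>The value \<open>s\<^sub>\<alpha>\<close> is exactly the one for which the right-hand side of the differential equation
  vanishes at \<open>- c\<^sub>\<alpha>\<close>. Differentiating that equation once more, only the terms \<open>1\<close> and
  \<open>- z\<^bsup>-2\<^esup> H\<^sub>\<alpha>(z)\<close> survive at this critical point.\<close>
lemma H_alpha_second_derivative:
  assumes "\<alpha> > 0"
  shows "(deriv (H_alpha \<alpha>) has_field_derivative of_real (1 - s_alpha \<alpha> / (c_alpha \<alpha>)\<^sup>2))
            (at (- of_real (c_alpha \<alpha>)))"
proof -
  let ?c = "c_alpha \<alpha>" and ?z = "- complex_of_real (c_alpha \<alpha>)"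
  let ?S = "- complex_of_real ` {0..}"
  let ?H' = "\<lambda>z. of_real \<alpha> + z + (inverse z - 1) * H_alpha \<alpha> z"
  have c: "?c > 0" using c_alpha_pos [OF assms] .
  have "complex_of_real ` {0..} = \<real>\<^sub>\<ge>\<^sub>0"
    by (auto simp: nonneg_Reals_def)
  then have opn: "open ?S"
    by (simp add: open_Compl closed_nonneg_Reals_complex)
  have mem: "?z \<in> ?S"
    using c by (auto simp: complex_eq_iff)
  have Hz: "H_alpha \<alpha> ?z = of_real (s_alpha \<alpha>)"
    by (rule of_real_s_alpha [symmetric])
  have crit: "?H' ?z = 0"
  proof -
    have "?H' ?z = of_real (\<alpha> - ?c + (- inverse ?c - 1) * s_alpha \<alpha>)"
      unfolding Hz by simp
    also have "(- inverse ?c - 1) * s_alpha \<alpha> = ((- inverse ?c - 1) * (?c / (1 + ?c))) * (\<alpha> - ?c)"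
      unfolding s_alpha_eq [OF assms] by (simp only: mult.assoc)
    also have "(- inverse ?c - 1) * (?c / (1 + ?c)) = - 1"
      using c by (simp add: divide_simps)
    finally show ?thesis by simp
  qed
  have "(?H' has_field_derivative
      (0 + 1 + ((- (inverse ?z * 1 * inverse ?z) - 0) * H_alpha \<alpha> ?z + ?H' ?z * (inverse ?z - 1)))) (at ?z)"
    using c by (intro DERIV_add DERIV_const DERIV_ident DERIV_mult DERIV_diff DERIV_inverse'
        H_alpha_has_field_derivative mem) auto
  moreover have "0 + 1 + ((- (inverse ?z * 1 * inverse ?z) - 0) * H_alpha \<alpha> ?z + ?H' ?z * (inverse ?z - 1))
      = of_real (1 - s_alpha \<alpha> / ?c\<^sup>2)"
    unfolding crit unfolding Hz using c by (simp add: field_simps power2_eq_square)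
  ultimately have "(?H' has_field_derivative of_real (1 - s_alpha \<alpha> / ?c\<^sup>2)) (at ?z)"
    by simp
  then show ?thesis
  proof (rule DERIV_cong_ev [THEN iffD1, rotated -1])
    show "\<forall>\<^sub>F z in nhds ?z. ?H' z = deriv (H_alpha \<alpha>) z"
      using eventually_nhds_in_open [OF opn mem]
      by eventually_elim (rule DERIV_imp_deriv [OF H_alpha_has_field_derivative, symmetric])
  qed auto
qed

section \<open>Dependence on the parameter\<close>

lemma c_alpha_less_iff:
  assumes "\<alpha> > 0" "c > 0"
  shows "c_alpha \<alpha> < c \<longleftrightarrow> critical_fun c < 1 / \<alpha>"
    and "c < c_alpha \<alpha> \<longleftrightarrow> 1 / \<alpha> < critical_fun c"
  using critical_fun_less_iff c_alpha_pos [OF assms(1)] assms(2)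
  by (auto simp flip: critical_fun_c_alpha [OF assms(1)])

text \<open>The inverse of a strictly monotone function is continuous: the level \<open>1/u\<close> stays on the same
  side of any given value of \<open>critical_fun\<close> for \<open>u\<close> near \<open>\<alpha>\<close>.\<close>
lemma isCont_c_alpha:
  assumes "\<alpha> > 0"
  shows "isCont c_alpha \<alpha>"
  unfolding isCont_def
proof (rule order_tendstoI)
  have lim: "((\<lambda>u. 1 / u) \<longlongrightarrow> 1 / \<alpha>) (at \<alpha>)"
    using assms by (intro tendsto_intros) auto
  have pos: "\<forall>\<^sub>F u in at \<alpha>. u > 0"
    using assms by (intro order_tendstoD(1) [OF tendsto_ident_at])
  show "\<forall>\<^sub>F u in at \<alpha>. a < c_alpha u" if a: "a < c_alpha \<alpha>" for a
  proof (cases "a > 0")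
    case True
    then have "1 / \<alpha> < critical_fun a"
      using a c_alpha_less_iff [OF assms] by simp
    from order_tendstoD(2) [OF lim this] pos show ?thesis
      by eventually_elim (simp add: c_alpha_less_iff True)
  next
    case False
    from pos show ?thesis
      by eventually_elim (use False c_alpha_pos in force)
  qed
  show "\<forall>\<^sub>F u in at \<alpha>. c_alpha u < a" if a: "c_alpha \<alpha> < a" for a
  proof -
    have "a > 0" using a c_alpha_pos [OF assms] by simp
    then have "critical_fun a < 1 / \<alpha>"
      using a c_alpha_less_iff [OF assms] by simp
    from order_tendstoD(1) [OF lim this] pos show ?thesis
      by eventually_elim (simp add: c_alpha_less_iff \<open>a > 0\<close>)
  qed
qed

lemma c_alpha_DERIV:
  assumes "\<alpha> > 0"
  shows "(c_alpha has_real_derivative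
            (c_alpha \<alpha> * (1 + c_alpha \<alpha>) / (\<alpha> * (\<alpha> - 2 * c_alpha \<alpha> - (c_alpha \<alpha>)\<^sup>2)))) (at \<alpha>)"
proof -
  let ?c = "c_alpha \<alpha>"
  have c: "?c > 0" using c_alpha_pos [OF assms] .
  have ne: "\<alpha> - 2 * ?c - ?c\<^sup>2 \<noteq> 0" using c_alpha_less [OF assms] by simp
  have "((\<lambda>c. inverse (critical_fun c)) has_real_derivative
      - (inverse (critical_fun ?c) * ((2 + ?c) * exp_stieltjes_real ?c - 1 / ?c - 1) * inverse (critical_fun ?c))) (at ?c)"
    by (rule DERIV_inverse' [OF critical_fun_DERIV [OF c]])
       (use assms critical_fun_c_alpha [OF assms] in simp)
  moreover have "- (inverse (critical_fun ?c) * ((2 + ?c) * exp_stieltjes_real ?c - 1 / ?c - 1) * inverse (critical_fun ?c))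
      = \<alpha> * (\<alpha> - 2 * ?c - ?c\<^sup>2) / (?c * (1 + ?c))" (is "_ = ?D")
    unfolding critical_fun_deriv_c_alpha [OF assms] critical_fun_c_alpha [OF assms]
    using assms c by (simp add: divide_simps) (simp add: algebra_simps)
  ultimately have D: "((\<lambda>c. inverse (critical_fun c)) has_real_derivative ?D) (at ?c)"
    by simp
  have "(c_alpha has_real_derivative inverse ?D) (at \<alpha>)"
    by (rule DERIV_inverse_function [where f = "\<lambda>c. inverse (critical_fun c)" and g = c_alpha and x = \<alpha> and a = 0 and b = "\<alpha> + 1", OF D])
       (use assms c ne isCont_c_alpha critical_fun_c_alpha in \<open>auto\<close>)
  then show ?thesis by simp
qed

lemma s_alpha_DERIV:
  assumes "\<alpha> > 0"
  shows "(s_alpha has_real_derivative (c_alpha \<alpha> * (\<alpha> + 1) / (\<alpha> * (1 + c_alpha \<alpha>)))) (at \<alpha>)"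
proof -
  let ?c = "c_alpha \<alpha>"
  let ?c' = "?c * (1 + ?c) / (\<alpha> * (\<alpha> - 2 * ?c - ?c\<^sup>2))"
  have c: "?c > 0" using c_alpha_pos [OF assms] .
  define w where "w = \<alpha> - 2 * ?c - ?c\<^sup>2"
  have w: "w \<noteq> 0" using c_alpha_less [OF assms] by (simp add: w_def)
  have "((\<lambda>u. c_alpha u * (u - c_alpha u) / (1 + c_alpha u)) has_real_derivative
      ((?c' * (\<alpha> - ?c) + (1 - ?c') * ?c) * (1 + ?c) - (?c * (\<alpha> - ?c)) * (0 + ?c')) / ((1 + ?c) * (1 + ?c))) (at \<alpha>)"
    using c by (intro DERIV_divide DERIV_mult DERIV_diff DERIV_add DERIV_const DERIV_ident c_alpha_DERIV assms) auto
  moreover have "((?c' * (\<alpha> - ?c) + (1 - ?c') * ?c) * (1 + ?c) - (?c * (\<alpha> - ?c)) * (0 + ?c')) / ((1 + ?c) * (1 + ?c))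
     = ?c * (\<alpha> + 1) / (\<alpha> * (1 + ?c))"
  proof -
    have "(?c' * (\<alpha> - ?c) + (1 - ?c') * ?c) * (1 + ?c) - (?c * (\<alpha> - ?c)) * (0 + ?c')
        = ?c' * w + ?c * (1 + ?c)"
    proof -
      have "(d * (\<alpha> - ?c) + (1 - d) * ?c) * (1 + ?c) - (?c * (\<alpha> - ?c)) * (0 + d)
          = d * w + ?c * (1 + ?c)" for d
        unfolding w_def by (simp add: algebra_simps power2_eq_square)
      then show ?thesis .
    qed
    also have "?c' * w = ?c * (1 + ?c) / \<alpha>"
      using w unfolding w_def by simp
    also have "?c * (1 + ?c) / \<alpha> + ?c * (1 + ?c) = ?c * (\<alpha> + 1) * (1 + ?c) / \<alpha>"
      using assms by (simp add: field_simps)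
    finally show ?thesis
      using c by simp
  qed
  ultimately have "((\<lambda>u. c_alpha u * (u - c_alpha u) / (1 + c_alpha u)) has_real_derivative
      ?c * (\<alpha> + 1) / (\<alpha> * (1 + ?c))) (at \<alpha>)"
    by simp
  then show ?thesis
  proof (rule DERIV_cong_ev [THEN iffD1, rotated -1])
    have "\<forall>\<^sub>F u in nhds \<alpha>. u \<in> {0<..}"
      using assms by (intro eventually_nhds_in_open) auto
    then show "\<forall>\<^sub>F u in nhds \<alpha>. c_alpha u * (u - c_alpha u) / (1 + c_alpha u) = s_alpha u"
      by eventually_elim (simp add: s_alpha_eq)
  qed auto
qed

lemma s_alpha_tendsto_0: "(s_alpha \<longlongrightarrow> 0) (at_right 0)"
proof (rule tendsto_sandwich)
  have pos: "\<forall>\<^sub>F u in at_right 0. u > (0::real)"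
    by (simp add: eventually_at_right_less)
  show "\<forall>\<^sub>F u in at_right 0. 0 \<le> s_alpha u"
    using pos
  proof eventually_elim
    case (elim u)
    then show ?case
      using s_alpha_gt_c_alpha_squared [of u] zero_le_power2 [of "c_alpha u"] by linarith
  qed
  show "\<forall>\<^sub>F u in at_right 0. s_alpha u \<le> u"
    using pos
  proof eventually_elim
    case (elim u)
    have c: "c_alpha u > 0" using c_alpha_pos [OF elim] .
    have "c_alpha u / (1 + c_alpha u) * (u - c_alpha u) \<le> 1 * (u - c_alpha u)"
      using c c_alpha_less [OF elim] zero_le_power2 [of "c_alpha u"]
      by (intro mult_right_mono) (simp, linarith)
    then show ?case
      using s_alpha_eq [OF elim] c by simp
  qed
qed (auto intro: tendsto_eq_intros)

lemma c_alpha_mono: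
  assumes "0 < a" "a \<le> b"
  shows "c_alpha a \<le> c_alpha b"
proof -
  have "b > 0" using assms by simp
  have "\<not> critical_fun (c_alpha a) < 1 / b"
    using assms by (simp add: critical_fun_c_alpha frac_le not_less)
  then show ?thesis
    using c_alpha_less_iff(1) [OF \<open>b > 0\<close> c_alpha_pos [OF assms(1)]] by simp
qed

text \<open>Since \<open>c\<^sub>\<alpha>\<close> increases, the factor \<open>c\<^sub>\<alpha> / (1 + c\<^sub>\<alpha>)\<close> is bounded below by its value at \<open>\<alpha> = 1\<close>,
  while \<open>\<alpha> - c\<^sub>\<alpha>\<close> is at least \<open>\<alpha>/2\<close>; so \<open>s\<^sub>\<alpha>\<close> grows at least linearly.\<close>
lemma s_alpha_at_top: "filterlim s_alpha at_top at_top"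
proof (rule filterlim_at_top_mono)
  let ?k = "c_alpha 1 / (1 + c_alpha 1)"
  have c1: "c_alpha 1 > 0" by (rule c_alpha_pos) simp
  then have "?k / 2 > 0" by simp
  then show "filterlim (\<lambda>u. ?k / 2 * u) at_top at_top"
    by (rule filterlim_tendsto_pos_mult_at_top [OF tendsto_const _ filterlim_ident])
  show "\<forall>\<^sub>F u in at_top. ?k / 2 * u \<le> s_alpha u"
    using eventually_ge_at_top [of 1]
  proof eventually_elim
    case (elim u)
    then have u: "u > 0" by simp
    have c: "c_alpha u > 0" using c_alpha_pos [OF u] .
    have m: "c_alpha 1 \<le> c_alpha u" using c_alpha_mono elim by simp
    have "?k \<le> c_alpha u / (1 + c_alpha u)"
      using c c1 m by (simp add: divide_simps) (simp add: algebra_simps)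
    moreover have "u / 2 \<le> u - c_alpha u"
      using c_alpha_less [OF u] zero_le_power2 [of "c_alpha u"] by linarith
    ultimately have "?k * (u / 2) \<le> c_alpha u / (1 + c_alpha u) * (u - c_alpha u)"
      using c u by (intro mult_mono) auto
    then show ?case
      using s_alpha_eq [OF u] by simp
  qed
qed

section \<open>Real analyticity\<close>

text \<open>It suffices that \<open>f\<close> agrees near each point of \<open>S\<close> with a function holomorphic on a complex
  disc: for real arguments the real part of the Taylor series is the series of the real parts of
  the coefficients.\<close>
lemma real_analytic_onI:
  assumes "\<And>x. x \<in> S \<Longrightarrow> \<exists>h. h analytic_on {of_real x} \<and> (\<forall>\<^sub>F y in nhds x. h (of_real y) = of_real (f y))"
  shows "real_analytic_on f S"
  unfolding real_analytic_on_def
proof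
  fix x assume "x \<in> S"
  then obtain h where h: "h analytic_on {of_real x}" and ev: "\<forall>\<^sub>F y in nhds x. h (of_real y) = of_real (f y)"
    using assms by blast
  obtain r where r: "r > 0" "h holomorphic_on ball (of_real x) r"
    using h analytic_at_ball by blast
  obtain d where d: "d > 0" "\<And>y. dist y x < d \<Longrightarrow> h (of_real y) = of_real (f y)"
    using ev unfolding eventually_nhds_metric by blast
  define a where "a n = (deriv ^^ n) h (of_real x) / fact n" for n
  have "(\<lambda>n. Re (a n) * (y - x) ^ n) sums f y" if y: "y \<in> ball x (min r d)" for y
  proof -
    have "of_real y \<in> ball (complex_of_real x) r"
      using y by (simp add: dist_of_real)
    from holomorphic_power_series [OF r(2) this]
    have "(\<lambda>n. a n * (of_real y - of_real x) ^ n) sums of_real (f y)"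
      using d(2) [of y] y by (simp add: a_def dist_commute)
    then have "(\<lambda>n. Re (a n * (of_real y - of_real x) ^ n)) sums Re (of_real (f y))"
      by (rule sums_Re)
    moreover have "Re (a n * (of_real y - of_real x) ^ n) = Re (a n) * (y - x) ^ n" for n
      by (simp flip: of_real_diff of_real_power)
    ultimately show ?thesis by simp
  qed
  then show "\<exists>r>0. \<exists>a. \<forall>y\<in>ball x r. (\<lambda>n. a n * (y - x) ^ n) sums f y"
    using r(1) d(1) by (intro exI [of _ "min r d"] conjI exI [of _ "\<lambda>n. Re (a n)"]) auto
qed

text \<open>The holomorphic inverse function theorem provides some local inverse of \<open>F\<close>. Continuity of \<open>g\<close>
  keeps \<open>g u\<close> inside the disc on which \<open>F\<close> is injective, which forces \<open>g\<close> to be that inverse on the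
  real axis.\<close>
lemma analytic_extension_of_inverse:
  fixes g :: "real \<Rightarrow> real"
  assumes F: "F analytic_on {complex_of_real (g y)}" and F': "deriv F (of_real (g y)) \<noteq> 0"
    and g: "isCont g y" and Fg: "\<forall>\<^sub>F u in nhds y. F (of_real (g u)) = of_real u"
  shows "\<exists>h. h analytic_on {of_real y} \<and> (\<forall>\<^sub>F u in nhds y. h (of_real u) = of_real (g u))"
proof -
  obtain r where r: "r > 0" "F holomorphic_on ball (of_real (g y)) r"
    using F analytic_at_ball by blast
  obtain e where e: "e > 0" "ball (complex_of_real (g y)) e \<subseteq> ball (of_real (g y)) r"
     and inj: "inj_on F (ball (of_real (g y)) e)"
  proof -
    have "complex_of_real (g y) \<in> ball (of_real (g y)) r"
      using r(1) by simp
    from has_complex_derivative_locally_injective [OF r(2) this open_ball F'] show ?thesis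
      using that by blast
  qed
  let ?B = "ball (complex_of_real (g y)) e"
  have hol: "F holomorphic_on ?B"
    using r(2) e(2) holomorphic_on_subset by blast
  obtain h where h: "h holomorphic_on F ` ?B" "\<And>z. z \<in> ?B \<Longrightarrow> h (F z) = z"
    by (rule holomorphic_has_inverse [OF hol open_ball inj], rule that)
  have "open (F ` ?B)"
    by (rule open_mapping_thm3 [OF hol open_ball inj])
  moreover have "F (of_real (g y)) = of_real y"
    using Fg by (rule eventually_nhds_x_imp_x)
  then have "of_real y \<in> F ` ?B"
    using e(1) by (metis centre_in_ball image_eqI)
  ultimately have "h analytic_on {of_real y}"
    using h(1) unfolding analytic_at by (intro exI [of _ "F ` ?B"]) simp
  moreover have "\<forall>\<^sub>F u in nhds y. h (of_real u) = of_real (g u)"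
  proof -
    have "(g \<longlongrightarrow> g y) (nhds y)"
      using g by (simp add: isCont_def tendsto_at_iff_tendsto_nhds)
    from tendstoD [OF this e(1)] Fg show ?thesis
    proof eventually_elim
      case (elim u)
      then have "of_real (g u) \<in> ?B" by (simp add: dist_of_real dist_commute)
      from h(2) [OF this] show ?case using elim by simp
    qed
  qed
  ultimately show ?thesis by blast
qed

text \<open>The derivative of the extension \<open>F\<close> of \<open>1 / critical_fun\<close> at \<open>c\<^sub>\<alpha>\<close> is nonzero simply because its
  real inverse \<open>c\<^sub>\<alpha>\<close> is differentiable: the chain rule applied to \<open>F(c\<^sub>u) = u\<close> would otherwise give
  \<open>0 = 1\<close>.\<close>
lemma c_alpha_analytic_extension:
  assumes "\<alpha> > 0"
  shows "\<exists>h. h analytic_on {of_real \<alpha>} \<and> (\<forall>\<^sub>F u in nhds \<alpha>. h (of_real u) = of_real (c_alpha u))"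
proof (rule analytic_extension_of_inverse)
  let ?c = "c_alpha \<alpha>"
  have c: "?c > 0" using c_alpha_pos [OF assms] .
  define F where "F w = inverse ((1 + w) * exp_stieltjes 1 w - 1)" for w
  define c' where "c' = ?c * (1 + ?c) / (\<alpha> * (\<alpha> - 2 * ?c - ?c\<^sup>2))"
  have F_real: "F (of_real x) = of_real (inverse (critical_fun x))" for x
    unfolding F_def exp_stieltjes_1_of_real critical_fun_def by simp
  have "exp_stieltjes 1 holomorphic_on (- \<real>\<^sub>\<le>\<^sub>0)"
    using exp_stieltjes_has_field_derivative
    by (auto simp: holomorphic_on_open closed_nonpos_Reals_complex open_Compl)
  then have "exp_stieltjes 1 analytic_on {of_real ?c}"
    using of_real_notin_nonpos [OF c] unfolding analytic_at
    by (intro exI [of _ "- \<real>\<^sub>\<le>\<^sub>0"]) (simp add: closed_nonpos_Reals_complex open_Compl)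
  moreover have "(1 + of_real ?c) * exp_stieltjes 1 (of_real ?c) - 1 \<noteq> (0 :: complex)"
  proof -
    have "(1 + of_real ?c) * exp_stieltjes 1 (of_real ?c) - 1 = complex_of_real (critical_fun ?c)"
      unfolding exp_stieltjes_1_of_real critical_fun_def by simp
    then show ?thesis
      using critical_fun_c_alpha [OF assms] assms by simp
  qed
  ultimately show ana: "F analytic_on {of_real ?c}"
    unfolding F_def [abs_def] by (intro analytic_intros) auto
  show "isCont c_alpha \<alpha>"
    by (rule isCont_c_alpha [OF assms])
  have "\<forall>\<^sub>F u in nhds \<alpha>. u \<in> {0<..}"
    using assms by (intro eventually_nhds_in_open) auto
  then show "\<forall>\<^sub>F u in nhds \<alpha>. F (of_real (c_alpha u)) = of_real u"
    by eventually_elim (simp add: F_real critical_fun_c_alpha)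
  then have ev: "\<forall>\<^sub>F u in nhds \<alpha>. F (of_real (c_alpha u)) = of_real u" .
  show "deriv F (of_real ?c) \<noteq> 0"
  proof
    assume "deriv F (of_real ?c) = 0"
    then have "(F has_field_derivative 0) (at (of_real ?c))"
      using ana by (metis analytic_on_imp_differentiable_at DERIV_deriv_iff_field_differentiable singletonI)
    moreover have "((\<lambda>u. complex_of_real (c_alpha u)) has_vector_derivative of_real c') (at \<alpha>)"
      using c_alpha_DERIV [OF assms, folded c'_def]
      by (simp add: has_vector_derivative_of_real has_real_derivative_iff_has_vector_derivative)
    ultimately have "((\<lambda>u. F (of_real (c_alpha u))) has_vector_derivative of_real c' * 0) (at \<alpha>)"
      using field_vector_diff_chain_at [where f = "\<lambda>u. complex_of_real (c_alpha u)" and g = F]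
      unfolding o_def by blast
    then have "((\<lambda>u. complex_of_real u) has_vector_derivative 0) (at \<alpha>)"
      using ev by (subst (asm) has_vector_derivative_cong_ev) (auto elim: eventually_mono dest: eventually_nhds_x_imp_x)
    moreover have "((\<lambda>u. complex_of_real u) has_vector_derivative 1) (at \<alpha>)"
      by (auto intro!: derivative_eq_intros)
    ultimately show False
      using vector_derivative_unique_at by fastforce
  qed
qed

lemma real_analytic_c_alpha: "real_analytic_on c_alpha {0<..}"
  by (rule real_analytic_onI) (simp add: c_alpha_analytic_extension)

lemma real_analytic_s_alpha: "real_analytic_on s_alpha {0<..}"
proof (rule real_analytic_onI)
  fix \<alpha> :: real assume "\<alpha> \<in> {0<..}"
  then have \<alpha>: "\<alpha> > 0" by simp
  obtain h where h: "h analytic_on {of_real \<alpha>}"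
     and ev: "\<forall>\<^sub>F u in nhds \<alpha>. h (of_real u) = of_real (c_alpha u)"
    using c_alpha_analytic_extension [OF \<alpha>] by blast
  have "h (of_real \<alpha>) = of_real (c_alpha \<alpha>)"
    using ev by (rule eventually_nhds_x_imp_x)
  then have "1 + h (of_real \<alpha>) = of_real (1 + c_alpha \<alpha>)"
    by simp
  then have "1 + h (of_real \<alpha>) \<noteq> 0"
    using c_alpha_pos [OF \<alpha>] by (simp only: of_real_eq_0_iff)
  then have "(\<lambda>w. h w / (1 + h w) * (w - h w)) analytic_on {of_real \<alpha>}"
    using h by (intro analytic_intros) auto
  moreover have "\<forall>\<^sub>F u in nhds \<alpha>. u \<in> {0<..}"
    using \<alpha> by (intro eventually_nhds_in_open) auto
  with ev have "\<forall>\<^sub>F u in nhds \<alpha>. h (of_real u) / (1 + h (of_real u)) * (of_real u - h (of_real u)) = of_real (s_alpha u)"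
    by eventually_elim (simp add: s_alpha_eq)
  ultimately show "\<exists>h. h analytic_on {of_real \<alpha>} \<and> (\<forall>\<^sub>F u in nhds \<alpha>. h (of_real u) = of_real (s_alpha u))"
    by blast
qed

lemma strict_mono_s_alpha: "strict_mono_on {0<..} s_alpha"
proof (rule strict_mono_onI)
  fix a b :: real assume "a \<in> {0<..}" "b \<in> {0<..}" "a < b"
  show "s_alpha a < s_alpha b"
  proof (rule DERIV_pos_imp_increasing [OF \<open>a < b\<close>])
    fix x assume "a \<le> x"
    then have x: "x > 0" using \<open>a \<in> {0<..}\<close> by simp
    then have "c_alpha x * (x + 1) / (x * (1 + c_alpha x)) > 0"
      using c_alpha_pos [OF x] by simp
    then show "\<exists>y. (s_alpha has_real_derivative y) (at x) \<and> y > 0"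
      using s_alpha_DERIV [OF x] by blast
  qed
qed

theorem proposition4p2:
  shows
    "(\<forall>\<alpha>>0. \<forall>z \<in> - complex_of_real ` {0..}.
        (H_alpha \<alpha> has_field_derivative (of_real \<alpha> + z + (inverse z - 1) * H_alpha \<alpha> z)) (at z))
     \<and> (\<forall>\<alpha>>0. s_alpha \<alpha> = c_alpha \<alpha> / (1 + c_alpha \<alpha>) * (\<alpha> - c_alpha \<alpha>))
     \<and> (\<forall>\<alpha>>0.
          (deriv (H_alpha \<alpha>) has_field_derivative of_real (1 - s_alpha \<alpha> / (c_alpha \<alpha>)\<^sup>2))
            (at (- of_real (c_alpha \<alpha>)))
          \<and> 1 - s_alpha \<alpha> / (c_alpha \<alpha>)\<^sup>2 < 0)
     \<and> (s_alpha \<longlongrightarrow> 0) (at_right 0) \<and> filterlim s_alpha at_top at_top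
     \<and> real_analytic_on c_alpha {0<..}
     \<and> (\<forall>\<alpha>>0. (c_alpha has_real_derivative
            (c_alpha \<alpha> * (1 + c_alpha \<alpha>) / (\<alpha> * (\<alpha> - 2 * c_alpha \<alpha> - (c_alpha \<alpha>)\<^sup>2)))) (at \<alpha>))
     \<and> real_analytic_on s_alpha {0<..}
     \<and> (\<forall>\<alpha>>0. (s_alpha has_real_derivative
            (c_alpha \<alpha> * (\<alpha> + 1) / (\<alpha> * (1 + c_alpha \<alpha>)))) (at \<alpha>))
     \<and> strict_mono_on {0<..} s_alpha"
proof (intro conjI allI impI ballI)
  fix \<alpha> :: real assume \<alpha>: "\<alpha> > 0"
  show "1 - s_alpha \<alpha> / (c_alpha \<alpha>)\<^sup>2 < 0"
    using s_alpha_gt_c_alpha_squared [OF \<alpha>] c_alpha_pos [OF \<alpha>] by simp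
qed (rule H_alpha_has_field_derivative s_alpha_eq H_alpha_second_derivative
      s_alpha_tendsto_0 s_alpha_at_top real_analytic_c_alpha c_alpha_DERIV
      real_analytic_s_alpha s_alpha_DERIV strict_mono_s_alpha; assumption)+

end
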